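(* Consider the $T$-round committed-pricing game in the block model with utility from all purchases and individually rational buyers, with network matrix $E\in\mathbb{R}^{m\times m}$ and $A=\mathrm{diag}(\alpha_1,\dots,\alpha_m)$ (see context). Suppose the valuations are uniform on $[0,1]$ and $\|EA\|_\infty<1$. Then the optimal price sequence in the limit (as $n\to\infty$) is $p_t=\frac12$ for $t=T,\dots,1$, with optimal normalized revenue $$\frac14\,\mathbf{1}^TA\left(I+(EA)+(EA)^2+\dots+(EA)^{T-1}\right)\mathbf{1}.$$
   Context: Game. A monopolist with unlimited supply and zero marginal cost sells to $n$ buyers over $T$ rounds, indexed in decreasing order (round $T$ is first in time, round $1$ is last), announcing and committing to prices $(p_T,\dots,p_1)$. Each buyer buys at most one unit, at one of the rounds or never. Valuations are private and i.i.d. uniform on $[0,1]$; past purchases are publicly observed. The buyers are partitioned into $m$ blocks $G_1,\dots,G_m$ with $|G_k|=\alpha_kn$, $\alpha_k\in(0,1]$, $E\in\mathbb{R}^{m\times m}$ has nonnegative entries, and $g_{ij}=E_{kh}/n$ for $i\in G_k$, $j\in G_h$. Utility from all purchases. Buyer $i$ with valuation $v^{(i)}$ buying at round $t$ gets utility $v^{(i)}-p_t+\sum_{j\neq i}g_{ij}\mathbf{1}\{j\text{ buys at some }s\in\{1,\dots,T\}\}$, i.e. the network effect counts all buyers over the whole horizon. Buyers are forward-looking and individually rational: if a customer purchases at round $t$, her utility counting only the purchases that have already happened (at rounds $s>t$) must be non-negative. Buyers play the symmetric equilibrium, in which strategies depend only on the block, the valuation, the history and the prices. In the limit of many buyers the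 optimal price sequence is non-decreasing over time ($p_T\le\dots\le p_1$), and for such a price sequence a remaining buyer in block $G_h$ buys at round $t$ if and only if her valuation is at least a threshold $v_t^{(h)}$ determined by her utility, counting only purchases already made, being zero. The normalized revenue is the expected sum of prices paid divided by $n$. The optimal price sequence in the limit maximizes the limit, as $n\to\infty$, of the normalized revenue, and the optimal normalized revenue is the maximal value. $\|M\|_\infty=\max_i\sum_j|M_{ij}|$ and $\mathbf{1}$ is the all-ones vector.
   Formalization: Added hypothesis: every entry of 1 − ½(I+EA+…+(EA)^{T−1})1 is nonnegative (limiting thresholds at price ½ stay in [0,1]). Without it the claim fails: m=1, α=1, E=0.9, T=3 gives 0.6775, but price ½ earns at most ½ per buyer. *)

theory Defs
  imports "HOL-Analysis.Analysis"
begin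

section \<open>The game\<close>

text \<open>
  Buyers are \<open>0, \<dots>, n - 1\<close>; buyer \<open>i\<close> belongs to block \<open>b i\<close>, and the finite type \<open>'m\<close> indexes
  the blocks.  Rounds are numbered backwards: round \<open>T\<close> is played first and round \<open>1\<close> last, so
  "before round \<open>t\<close>" means "at a round \<open>s > t\<close>".  An outcome (and equally a public history, which
  is a partial outcome) maps each buyer to the round of her purchase, or to \<open>None\<close>.
\<close>

type_synonym outcome = "nat \<Rightarrow> nat option"

definition influence :: "real^'m^'m \<Rightarrow> nat \<Rightarrow> (nat \<Rightarrow> 'm) \<Rightarrow> nat \<Rightarrow> nat \<Rightarrow> real" where
  "influence E n b i j = E $ b i $ b j / real n"

definition utility ::
  "real^'m^'m \<Rightarrow> nat \<Rightarrow> (nat \<Rightarrow> 'm) \<Rightarrow> (nat \<Rightarrow> real) \<Rightarrow> (nat \<Rightarrow> real) \<Rightarrow> outcome \<Rightarrow> nat \<Rightarrow> nat \<Rightarrow> real"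
where
  "utility E n b p v x i t =
     v i - p t + (\<Sum>j\<in>{..<n} - {i}. influence E n b i j * of_bool (x j \<noteq> None))"

definition utility_past ::
  "real^'m^'m \<Rightarrow> nat \<Rightarrow> (nat \<Rightarrow> 'm) \<Rightarrow> (nat \<Rightarrow> real) \<Rightarrow> (nat \<Rightarrow> real) \<Rightarrow> outcome \<Rightarrow> nat \<Rightarrow> nat \<Rightarrow> real"
where
  "utility_past E n b p v x i t =
     v i - p t + (\<Sum>j\<in>{..<n} - {i}. influence E n b i j * of_bool (\<exists>s>t. x j = Some s))"

text \<open>
  A symmetric strategy: does a remaining buyer with the given block and valuation buy at the
  given round after the given history?  Committed prices are known from the start, so strategies
  for different price sequences are simply different functions of this type.
\<close>

type_synonym 'm strategy = "'m \<Rightarrow> real \<Rightarrow> nat \<Rightarrow> outcome \<Rightarrow> bool"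

primrec play ::
  "nat \<Rightarrow> (nat \<Rightarrow> 'm) \<Rightarrow> nat \<Rightarrow> 'm strategy \<Rightarrow> (nat \<Rightarrow> real) \<Rightarrow> nat \<Rightarrow> outcome"
where
  "play n b T \<sigma> v 0 = (\<lambda>i. None)"
| "play n b T \<sigma> v (Suc d) = (\<lambda>i.
     if i < n \<and> play n b T \<sigma> v d i = None \<and> \<sigma> (b i) (v i) (T - d) (play n b T \<sigma> v d)
     then Some (T - d) else play n b T \<sigma> v d i)"

text \<open>
  The first \<open>d\<close> rounds played are \<open>T, \<dots>, T - d + 1\<close>, and \<open>play \<dots> d\<close> is the history they produce.
\<close>

definition outcome_of ::
  "nat \<Rightarrow> (nat \<Rightarrow> 'm) \<Rightarrow> nat \<Rightarrow> 'm strategy \<Rightarrow> (nat \<Rightarrow> real) \<Rightarrow> outcome" where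
  "outcome_of n b T \<sigma> v = play n b T \<sigma> v T"

text \<open>
  The rounds at which individual rationality allows buyer \<open>i\<close> to purchase.
\<close>

definition ir_rounds ::
  "real^'m^'m \<Rightarrow> nat \<Rightarrow> (nat \<Rightarrow> 'm) \<Rightarrow> nat \<Rightarrow> (nat \<Rightarrow> real) \<Rightarrow> (nat \<Rightarrow> real) \<Rightarrow> outcome \<Rightarrow> nat \<Rightarrow> nat set"
where
  "ir_rounds E n b T p v x i = {t \<in> {1..T}. utility_past E n b p v x i t \<ge> 0}"

text \<open>
  Each buyer chooses a best purchase round among the individually rational ones, the purchases of
  the others being given: in a large market one buyer moves the utility of each other buyer only
  by \<open>O(1/n)\<close>.  An indifferent buyer buys, and buys as early as possible.  This is the tie-breaking
  for which non-decreasing prices lead to threshold play (\<open>threshold_play\<close> below).  For a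
  non-buyer the condition says that no round is individually rational; since \<open>E\<close> is nonnegative,
  \<open>utility \<ge> utility_past\<close>, so at every individually rational round she would buy.
\<close>

definition best_reply ::
  "real^'m^'m \<Rightarrow> nat \<Rightarrow> (nat \<Rightarrow> 'm) \<Rightarrow> nat \<Rightarrow> (nat \<Rightarrow> real) \<Rightarrow> (nat \<Rightarrow> real) \<Rightarrow> outcome \<Rightarrow> nat \<Rightarrow> bool"
where
  "best_reply E n b T p v x i \<longleftrightarrow>
     (case x i of
        None \<Rightarrow> ir_rounds E n b T p v x i = {}
      | Some t \<Rightarrow> t \<in> ir_rounds E n b T p v x i \<and>
          (\<forall>s \<in> ir_rounds E n b T p v x i.
             utility E n b p v x i s \<le> utility E n b p v x i t \<and>
             (s > t \<longrightarrow> utility E n b p v x i s < utility E n b p v x i t)))"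

definition symmetric_equilibrium ::
  "real^'m^'m \<Rightarrow> nat \<Rightarrow> (nat \<Rightarrow> 'm) \<Rightarrow> nat \<Rightarrow> (nat \<Rightarrow> real) \<Rightarrow> 'm strategy \<Rightarrow> bool"
where
  "symmetric_equilibrium E n b T p \<sigma> \<longleftrightarrow>
     (\<forall>v. (\<forall>i<n. v i \<in> {0..1}) \<longrightarrow>
        (\<forall>i<n. best_reply E n b T p v (outcome_of n b T \<sigma> v) i))"


section \<open>Revenue\<close>

text \<open>
  \<open>restrict_space lborel {0..1}\<close> is the uniform distribution on the unit interval.
\<close>

definition normalized_revenue ::
  "nat \<Rightarrow> (nat \<Rightarrow> 'm) \<Rightarrow> nat \<Rightarrow> (nat \<Rightarrow> real) \<Rightarrow> 'm strategy \<Rightarrow> real"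
where
  "normalized_revenue n b T p \<sigma> =
     (\<integral>v. (\<Sum>i<n. case outcome_of n b T \<sigma> v i of None \<Rightarrow> 0 | Some t \<Rightarrow> p t)
        \<partial>(\<Pi>\<^sub>M i\<in>{..<n}. restrict_space lborel {0..1})) / real n"

text \<open>
  \<open>R r q\<close> is the normalized revenue of the price sequence \<open>q\<close> in the \<open>r\<close>-th market of a growing
  sequence of markets.
\<close>

definition optimal_in_limit ::
  "(nat \<Rightarrow> (nat \<Rightarrow> real) \<Rightarrow> real) \<Rightarrow> (nat \<Rightarrow> real) \<Rightarrow> real \<Rightarrow> bool"
where
  "optimal_in_limit R p V \<longleftrightarrow>
     (\<lambda>r. R r p) \<longlonglongrightarrow> V \<and> (\<forall>q. \<exists>L. (\<lambda>r. R r q) \<longlonglongrightarrow> L \<and> L \<le> V)"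


section \<open>Matrices\<close>

definition diag :: "real^'m \<Rightarrow> real^'m^'m" where
  "diag a = (\<chi> i j. if i = j then a $ i else 0)"

text \<open>
  On \<open>real^'m^'m\<close> the operations \<open>*\<close> and \<open>^\<close> would be componentwise, hence an explicit power.
\<close>

primrec matrix_power :: "real^'m^'m \<Rightarrow> nat \<Rightarrow> real^'m^'m" where
  "matrix_power M 0 = mat 1"
| "matrix_power M (Suc k) = M ** matrix_power M k"

definition norm_infty :: "real^'m^'m \<Rightarrow> real" where
  "norm_infty M = Max (range (\<lambda>i. \<Sum>j\<in>UNIV. \<bar>M $ i $ j\<bar>))"


text \<open>
  With \<open>M = E ** diag \<alpha>\<close>, at the constant price 1/2 the limiting thresholds satisfy
  \<open>v\<^sub>t = 1/2 - M *v (1 - v\<^sub>t\<^sub>+\<^sub>1)\<close> with \<open>v\<^sub>T = 1/2\<close>, so the lowest ones are the last-round thresholds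
  \<open>v\<^sub>1 = 1 - 1/2 * (I + M + \<dots> + M^(T-1)) *v 1\<close>.  The fraction \<open>1 - v\<^sub>1\<close> of buyers served is a genuine
  fraction only if \<open>v\<^sub>1 \<ge> 0\<close>.  This holds if \<open>T \<le> 2\<close> or if the norm of \<open>M\<close> is at most 1/2, but
  does not follow from the norm of \<open>M\<close> being below 1: for one block, \<open>M = 9/10\<close> and \<open>T = 3\<close>
  it would mean serving 1.355 buyers per buyer.
\<close>


section \<open>Existence of equilibria, and threshold play for non-decreasing prices\<close>

lemma threshold_play:
  assumes eq: "symmetric_equilibrium E n b T p \<sigma>"
    and p: "\<And>s t. 1 \<le> s \<Longrightarrow> s \<le> t \<Longrightarrow> t \<le> T \<Longrightarrow> p t \<le> p s"
    and v: "\<And>i. i < n \<Longrightarrow> v i \<in> {0..1}"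
    and i: "i < n" and t: "t \<in> {1..T}"
  defines "x \<equiv> outcome_of n b T \<sigma> v"
  shows "x i = Some t \<longleftrightarrow>
    (\<forall>s>t. x i \<noteq> Some s) \<and>
    v i \<ge> p t - (\<Sum>j\<in>{..<n} - {i}. influence E n b i j * of_bool (\<exists>s>t. x j = Some s))"
proof -
  have br: "best_reply E n b T p v x i"
    using eq v i unfolding symmetric_equilibrium_def x_def by blast
  have ir: "t \<in> ir_rounds E n b T p v x i \<longleftrightarrow>
    v i \<ge> p t - (\<Sum>j\<in>{..<n} - {i}. influence E n b i j * of_bool (\<exists>s>t. x j = Some s))"
    using t by (auto simp: ir_rounds_def utility_past_def)
  show ?thesis
  proof (cases "x i")
    case None
    then show ?thesis using br ir by (auto simp: best_reply_def)
  next
    case (Some s)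
    have s: "s \<in> ir_rounds E n b T p v x i"
      and best: "t \<in> ir_rounds E n b T p v x i \<Longrightarrow> s < t \<Longrightarrow>
        utility E n b p v x i t < utility E n b p v x i s"
      using br Some by (auto simp: best_reply_def)
    have "\<not> s < t" if "t \<in> ir_rounds E n b T p v x i"
      using best[OF that] p[of s t] s t by (auto simp: utility_def ir_rounds_def)
    then show ?thesis using Some s ir by (auto simp: not_less_iff_gr_or_eq)
  qed
qed

lemma play_le:
  assumes "d \<le> T" "play n b T \<sigma> v d i = Some s"
  shows "T < s + d \<and> s \<le> T"
  using assms
proof (induction d)
  case (Suc d)
  then have "play n b T \<sigma> v d i = Some s \<or> s = T - d" by (auto split: if_splits)
  then show ?case using Suc by auto
qed simp

lemma play_mono: "play n b T \<sigma> v d i = Some s \<Longrightarrow> d \<le> e \<Longrightarrow> play n b T \<sigma> v e i = Some s"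
  by (induction e arbitrary: i) (auto simp: le_Suc_eq)

lemma play_back:
  "play n b T \<sigma> v e i = Some s \<Longrightarrow> e \<le> T \<Longrightarrow> T < s + d \<Longrightarrow> play n b T \<sigma> v d i = Some s"
proof (induction e)
  case (Suc e)
  show ?case
  proof (cases "play n b T \<sigma> v e i = Some s")
    case True
    then show ?thesis using Suc by simp
  next
    case False
    then have "s = T - e" using Suc.prems by (auto split: if_splits)
    then have "Suc e \<le> d" using Suc.prems by simp
    then show ?thesis using Suc.prems(1) play_mono by blast
  qed
qed simp

lemma play_eq:
  assumes t: "t \<in> {1..T}"
  shows "play n b T \<sigma> v (T - t) i = Some s \<longleftrightarrow> outcome_of n b T \<sigma> v i = Some s \<and> s > t"
proof
  assume h: "play n b T \<sigma> v (T - t) i = Some s"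
  have "T < s + (T - t)" using play_le[OF _ h] by simp
  then show "outcome_of n b T \<sigma> v i = Some s \<and> s > t"
    using play_mono[OF h, of T] t by (simp add: outcome_of_def)
next
  assume h: "outcome_of n b T \<sigma> v i = Some s \<and> s > t"
  then have "T < s + (T - t)" using t by auto
  with h show "play n b T \<sigma> v (T - t) i = Some s"
    using play_back[of n b T \<sigma> v T i s "T - t"] unfolding outcome_of_def by blast
qed

lemma outcome_iff:
  assumes "t \<in> {1..T}" "i < n"
  shows "outcome_of n b T \<sigma> v i = Some t \<longleftrightarrow>
    play n b T \<sigma> v (T - t) i = None \<and> \<sigma> (b i) (v i) t (play n b T \<sigma> v (T - t))"
proof -
  have T: "T - (T - t) = t" using assms by auto
  have "outcome_of n b T \<sigma> v i = Some t \<longleftrightarrow> play n b T \<sigma> v (Suc (T - t)) i = Some t"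
  proof
    assume "outcome_of n b T \<sigma> v i = Some t"
    then show "play n b T \<sigma> v (Suc (T - t)) i = Some t"
      unfolding outcome_of_def by (rule play_back) (use assms in auto)
  next
    assume "play n b T \<sigma> v (Suc (T - t)) i = Some t"
    then show "outcome_of n b T \<sigma> v i = Some t"
      unfolding outcome_of_def by (rule play_mono) (use assms in auto)
  qed
  also have "\<dots> \<longleftrightarrow> play n b T \<sigma> v (T - t) i = None \<and> \<sigma> (b i) (v i) t (play n b T \<sigma> v (T - t))"
    using assms play_eq[OF assms(1), of n b \<sigma> v i t] by (auto simp: T)
  finally show ?thesis .
qed

text \<open>
  The equilibrium strategy: buy as soon as this is individually rational and no lower price is
  still to come.
\<close>

lemma equilibrium_exists:
  fixes E :: "real^'m^'m"
  assumes E: "\<And>k h. E $ k $ h \<ge> 0"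
  shows "\<exists>\<sigma>. symmetric_equilibrium E n b T p \<sigma>"
proof -
  define \<sigma> :: "'m strategy" where
    "\<sigma> k w t x \<longleftrightarrow> w - p t + (\<Sum>j<n. E $ k $ b j / real n * of_bool (x j \<noteq> None)) \<ge> 0
       \<and> (\<forall>s\<in>{1..<t}. p t \<le> p s)" for k w t x
  have "best_reply E n b T p v (outcome_of n b T \<sigma> v) i" if i: "i < n" for v i
  proof -
    define x where "x = outcome_of n b T \<sigma> v"
    let ?F = "ir_rounds E n b T p v x i"
    have past: "play n b T \<sigma> v (T - t) j \<noteq> None \<longleftrightarrow> (\<exists>s>t. x j = Some s)" if "t \<in> {1..T}" for t j
      using play_eq[OF that, of n b \<sigma> v j] unfolding x_def by (metis not_None_eq)
    have buy: "x i = Some t \<longleftrightarrow> (\<forall>s>t. x i \<noteq> Some s) \<and> t \<in> ?F \<and> (\<forall>s\<in>{1..<t}. p t \<le> p s)"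
      if t: "t \<in> {1..T}" for t
    proof (cases "\<exists>s>t. x i = Some s")
      case True
      then show ?thesis by auto
    next
      case False
      have "(\<Sum>j<n. E $ b i $ b j / real n * of_bool (\<exists>s>t. x j = Some s)) =
            (\<Sum>j\<in>{..<n} - {i}. influence E n b i j * of_bool (\<exists>s>t. x j = Some s))"
        using i False by (subst sum.remove[of _ i]) (auto simp: influence_def)
      moreover have "play n b T \<sigma> v (T - t) i = None" using past[OF t, of i] False by blast
      ultimately show ?thesis
        using False t outcome_iff[OF t i, of b \<sigma> v] past[OF t]
        by (simp add: x_def[symmetric] \<sigma>_def ir_rounds_def utility_past_def)
    qed
    have range: "t \<in> {1..T}" if "x i = Some t" for t
      using play_le[of T T n b \<sigma> v i t] that unfolding x_def outcome_of_def by auto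
    have later: "s \<in> ?F" if "t \<in> ?F" "s \<in> {1..t}" "p s \<le> p t" for s t
    proof -
      have "(\<Sum>j\<in>{..<n} - {i}. influence E n b i j * of_bool (\<exists>r>t. x j = Some r))
         \<le> (\<Sum>j\<in>{..<n} - {i}. influence E n b i j * of_bool (\<exists>r>s. x j = Some r))"
        using that(2) E by (intro sum_mono mult_left_mono) (auto simp: influence_def of_bool_def)
      then show ?thesis using that by (auto simp: ir_rounds_def utility_past_def)
    qed
    have no_skip: "\<exists>r\<ge>s. x i = Some r" if "s \<in> ?F" "\<forall>r\<in>{1..<s}. p s \<le> p r" for s
    proof -
      have "s \<in> {1..T}" using that by (auto simp: ir_rounds_def)
      then show ?thesis using buy[of s] that by (metis order_less_imp_le order_refl)
    qed
    have candidate: "\<exists>s. s \<in> ?F \<and> s \<le> t \<and> p s \<le> p t \<and> (\<forall>r\<in>{1..<s}. p s \<le> p r)"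
      if "t \<in> ?F" for t
      using that
    proof (induction t rule: less_induct)
      case (less t)
      show ?case
      proof (cases "\<forall>r\<in>{1..<t}. p t \<le> p r")
        case True
        then show ?thesis using less.prems by blast
      next
        case False
        then obtain r where r: "r \<in> {1..<t}" "p r < p t" by force
        then have "r \<in> ?F" using later[OF less.prems, of r] by auto
        with less.IH[of r] r show ?thesis by fastforce
      qed
    qed
    show ?thesis
    proof (cases "x i")
      case None
      then have "?F = {}" using candidate no_skip by fastforce
      then show ?thesis using None by (simp add: best_reply_def x_def)
    next
      case (Some t)
      have t: "t \<in> ?F" "\<forall>s\<in>{1..<t}. p t \<le> p s" using buy[OF range[OF Some]] Some by auto
      have "p t \<le> p s \<and> (s > t \<longrightarrow> p t < p s)" if s: "s \<in> ?F" for s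
      proof (cases "s \<le> t")
        case True
        then show ?thesis using t s by (cases "s = t") (auto simp: ir_rounds_def)
      next
        case False
        obtain r where r: "r \<in> ?F" "r \<le> s" "p r \<le> p s" "\<forall>q\<in>{1..<r}. p r \<le> p q"
          using candidate[OF s] by blast
        then have "r \<le> t" using no_skip[of r] Some by auto
        then have "p t \<le> p r" using t r by (cases "r = t") (auto simp: ir_rounds_def)
        moreover have "p s \<noteq> p t"
        proof
          assume st: "p s = p t"
          have "p s \<le> p q" if q: "q \<in> {1..<s}" for q
          proof (rule ccontr)
            assume "\<not> p s \<le> p q"
            then have q': "p q < p t" "q \<in> ?F" using st later[OF s, of q] q by auto
            obtain u where u: "u \<in> ?F" "u \<le> q" "p u \<le> p q" "\<forall>q\<in>{1..<u}. p u \<le> p q"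
              using candidate[OF q'(2)] by blast
            then have "u \<le> t" using no_skip[of u] Some by auto
            then have "p t \<le> p u" using t u by (cases "u = t") (auto simp: ir_rounds_def)
            then show False using u q' by simp
          qed
          then show False using no_skip[OF s] Some False by auto
        qed
        ultimately show ?thesis using r by auto
      qed
      then show ?thesis using Some t by (auto simp: best_reply_def utility_def x_def)
    qed
  qed
  then show ?thesis unfolding symmetric_equilibrium_def by blast
qed

end

theory Submission
  imports Defs "HOL-Probability.Infinite_Product_Measure"
begin

text \<open>
  In every equilibrium a buyer buys at the first individually rational round after which no lower
  price follows (a candidate round), so only the non-decreasing subsequence of candidate prices
  matters, and the set of buyers served is described by one random threshold per block.  By the
  law of large numbers these thresholds converge in \<open>L\<^sup>1\<close> to those of a deterministic recursion.

  Let \<open>M = E A\<close>, and let \<open>d\<^sub>c\<close> be the vector of fractions served at the \<open>c\<close>-th candidate round, at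
  price \<open>p\<^sub>c\<close>.  In the limit \<open>d\<^sub>1 \<le> (1 - p\<^sub>1)\<^sup>+ 1\<close> and \<open>d\<^sub>c\<^sub>+\<^sub>1 \<le> (M d\<^sub>c - (p\<^sub>c\<^sub>+\<^sub>1 - p\<^sub>c) 1)\<^sup>+\<close>.  Since
  \<open>M\<^sup>c 1 \<le> 1\<close>, induction gives \<open>d\<^sub>c \<le> (1 - p\<^sub>c)\<^sup>+ M\<^sup>c\<^sup>-\<^sup>1 1\<close>, hence \<open>p\<^sub>c d\<^sub>c \<le> 1/4 M\<^sup>c\<^sup>-\<^sup>1 1\<close>.  At the
  constant price 1/2 all these inequalities are equalities.
\<close>

section \<open>Threshold play in equilibrium\<close>

text \<open>Rounds count down, so \<open>s < t\<close> is later than \<open>t\<close>: after a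
  candidate round, waiting cannot lower the price.\<close>

definition candidate :: "(nat \<Rightarrow> real) \<Rightarrow> nat \<Rightarrow> bool" where
  "candidate p t \<longleftrightarrow> (\<forall>s\<in>{1..<t}. p t \<le> p s)"

text \<open>Utility counts the purchases of the whole horizon, so its network term is the same at
  every round, and a buyer takes the cheapest individually rational round, the earliest one in case
  of a tie. That round is a candidate, and no earlier candidate is individually rational, since it
  would be at least as cheap.\<close>

lemma best_reply_buys_iff:
  fixes E :: "real^'m^'m"
  assumes E: "\<And>k h. E $ k $ h \<ge> 0"
    and br: "best_reply E n b T p v x i"
  shows "x i = Some t \<longleftrightarrow>
    (\<forall>s>t. x i \<noteq> Some s) \<and> candidate p t \<and> t \<in> ir_rounds E n b T p v x i"
proof -
  let ?F = "ir_rounds E n b T p v x i"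
  \<comment> \<open>Waiting only adds past purchases, so with nonnegative \<open>E\<close>
    individual rationality persists unless the price rises.\<close>
  have later: "s \<in> ?F" if "t \<in> ?F" "s \<in> {1..t}" "p s \<le> p t" for s t
  proof -
    have "(\<Sum>j\<in>{..<n} - {i}. influence E n b i j * of_bool (\<exists>r>t. x j = Some r))
       \<le> (\<Sum>j\<in>{..<n} - {i}. influence E n b i j * of_bool (\<exists>r>s. x j = Some r))"
      using that(2) E by (intro sum_mono mult_left_mono) (auto simp: influence_def of_bool_def)
    then show ?thesis using that by (auto simp: ir_rounds_def utility_past_def)
  qed
  show ?thesis
  proof (cases "x i")
    case None
    then show ?thesis using br by (auto simp: best_reply_def)
  next
    case (Some t')
    have t': "t' \<in> ?F" and best: "\<And>s. s \<in> ?F \<Longrightarrow> p t' \<le> p s"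
      and early: "\<And>s. s \<in> ?F \<Longrightarrow> s > t' \<Longrightarrow> p t' < p s"
      using br Some by (auto simp: best_reply_def utility_def)
    have cand: "candidate p t'"
      unfolding candidate_def
    proof (rule ballI, rule ccontr)
      fix s assume s: "s \<in> {1..<t'}" "\<not> p t' \<le> p s"
      then have "s \<in> ?F" using later[OF t', of s] by auto
      then show False using best s by auto
    qed
    have "t = t'" if "\<not> t < t'" "candidate p t" "t \<in> ?F"
    proof (rule ccontr)
      assume "t \<noteq> t'"
      then have "t > t'" using that by simp
      then have "p t \<le> p t'" using that(2) t' by (auto simp: candidate_def ir_rounds_def)
      then show False using early[OF that(3) \<open>t > t'\<close>] by simp
    qed
    then show ?thesis using Some t' cand by auto
  qed
qed

text \<open>
  The threshold after the first \<open>d\<close> rounds played, when \<open>F h \<theta>\<close> buyers of block \<open>h\<close> per buyer in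
  the market have valuation at least \<open>\<theta>\<close>.  Taking \<open>F\<close> empirical gives the finite market, taking it
  uniform gives the limit.  The initial value 2 exceeds every valuation: nobody has bought yet.
\<close>

primrec threshold ::
  "real^'m^'m \<Rightarrow> (nat \<Rightarrow> real) \<Rightarrow> nat \<Rightarrow> ('m \<Rightarrow> real \<Rightarrow> real) \<Rightarrow> nat \<Rightarrow> 'm \<Rightarrow> real"
where
  "threshold E p T F 0 k = 2"
| "threshold E p T F (Suc d) k =
    (if candidate p (T - d)
     then min (threshold E p T F d k) (p (T - d) - (\<Sum>h\<in>UNIV. E $ k $ h * F h (threshold E p T F d h)))
     else threshold E p T F d k)"

text \<open>Normalised by the market and not by the block, so that the factor \<open>1/n\<close> of
  \<open>influence\<close> is absorbed and \<open>E\<close> acts directly on tails.\<close>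

definition emp_tail :: "nat \<Rightarrow> (nat \<Rightarrow> 'm) \<Rightarrow> (nat \<Rightarrow> real) \<Rightarrow> 'm \<Rightarrow> real \<Rightarrow> real" where
  "emp_tail n b v k \<theta> = (\<Sum>i<n. of_bool (b i = k \<and> \<theta> \<le> v i)) / real n"

text \<open>The probability that a uniform valuation reaches \<open>\<theta>\<close>. The clipping
  matters: thresholds start at 2 and may become negative.\<close>

definition unif_tail :: "real \<Rightarrow> real" where
  "unif_tail \<theta> = max 0 (min 1 (1 - \<theta>))"

text \<open>Each buyer lies in exactly one block. Taking a row of \<open>E\<close> for
  \<open>f\<close> gives the network effect, and \<open>f = 1\<close> gives the fraction of buyers
  served.\<close>

lemma sum_emp_tail:
  fixes b :: "nat \<Rightarrow> 'm::finite"
  shows "(\<Sum>h\<in>UNIV. f h * emp_tail n b v h (\<theta> h)) = (\<Sum>j<n. f (b j) / real n * of_bool (\<theta> (b j) \<le> v j))"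
proof -
  have "(\<Sum>h\<in>UNIV. f h * emp_tail n b v h (\<theta> h)) =
      (\<Sum>h\<in>UNIV. \<Sum>j<n. f h / real n * of_bool (b j = h \<and> \<theta> h \<le> v j))"
    by (simp only: emp_tail_def sum_distrib_left sum_divide_distrib times_divide_eq_left times_divide_eq_right)
  also have "\<dots> = (\<Sum>j<n. \<Sum>h\<in>UNIV. f h / real n * of_bool (b j = h \<and> \<theta> h \<le> v j))"
    by (rule sum.swap)
  also have "\<dots> = (\<Sum>j<n. \<Sum>h\<in>UNIV. if b j = h then f h / real n * of_bool (\<theta> h \<le> v j) else 0)"
    by (intro sum.cong) auto
  finally show ?thesis by simp
qed

text \<open>By \<open>best_reply_buys_iff\<close> a remaining buyer buys at a candidate round
  exactly when her valuation reaches the price minus the network effect so far, a cutoff common to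
  her block. The running minimum of these cutoffs separates the buyers served from the
  others.\<close>

lemma play_threshold:
  fixes E :: "real^'m^'m"
  assumes E: "\<And>k h. E $ k $ h \<ge> 0"
    and eq: "symmetric_equilibrium E n b T p \<sigma>"
    and v: "\<And>i. i < n \<Longrightarrow> v i \<in> {0..1}"
    and d: "d \<le> T" and i: "i < n"
  shows "play n b T \<sigma> v d i \<noteq> None \<longleftrightarrow> threshold E p T (emp_tail n b v) d (b i) \<le> v i"
  using d i
proof (induction d arbitrary: i)
  case 0
  then show ?case using v[of i] by simp
next
  case (Suc d)
  define x where "x = outcome_of n b T \<sigma> v"
  define t where "t = T - d"
  have t: "t \<in> {1..T}" and d_eq: "d = T - t" using Suc.prems by (auto simp: t_def)
  let ?\<theta> = "threshold E p T (emp_tail n b v) d"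
  have past: "(\<exists>s>t. x j = Some s) \<longleftrightarrow> ?\<theta> (b j) \<le> v j" if "j < n" for j
  proof -
    have "play n b T \<sigma> v d j \<noteq> None \<longleftrightarrow> (\<exists>s>t. x j = Some s)"
      using play_eq[OF t, of n b \<sigma> v j] unfolding x_def d_eq by (metis not_None_eq)
    then show ?thesis using Suc.IH[OF _ that] Suc.prems by simp
  qed
  have "best_reply E n b T p v x i"
    using eq v Suc.prems unfolding symmetric_equilibrium_def x_def by blast
  note buys = best_reply_buys_iff[OF E this, of t]
  have step: "play n b T \<sigma> v (Suc d) i \<noteq> None \<longleftrightarrow> play n b T \<sigma> v d i \<noteq> None \<or> x i = Some t"
    using outcome_iff[OF t Suc.prems(2), of b \<sigma> v] Suc.prems unfolding x_def d_eq[symmetric]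
    by (auto simp: t_def)
  show ?case
  proof (cases "?\<theta> (b i) \<le> v i")
    case True
    then have "play n b T \<sigma> v d i \<noteq> None" using Suc.IH[of i] Suc.prems by auto
    then show ?thesis using step True by auto
  next
    case False
    then have none: "play n b T \<sigma> v d i = None" using Suc.IH[of i] Suc.prems by auto
    have no: "\<forall>s>t. x i \<noteq> Some s" using past[OF Suc.prems(2)] False by simp
    \<comment> \<open>Buyer \<open>i\<close> has not bought yet, so her own term is zero and may be
      added; this makes the cutoff depend on \<open>i\<close> through \<open>b i\<close>
      alone.\<close>
    have "(\<Sum>j\<in>{..<n} - {i}. influence E n b i j * of_bool (\<exists>s>t. x j = Some s)) =
        (\<Sum>j<n. influence E n b i j * of_bool (\<exists>s>t. x j = Some s))"
      using Suc.prems(2) no by (subst (2) sum.remove[of _ i]) auto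
    also have "\<dots> = (\<Sum>j<n. E $ b i $ b j / real n * of_bool (?\<theta> (b j) \<le> v j))"
      using past by (intro sum.cong) (auto simp: influence_def)
    also have "\<dots> = (\<Sum>h\<in>UNIV. E $ b i $ h * emp_tail n b v h (?\<theta> h))"
      by (rule sum_emp_tail[symmetric])
    finally have "t \<in> ir_rounds E n b T p v x i \<longleftrightarrow>
        p t - (\<Sum>h\<in>UNIV. E $ b i $ h * emp_tail n b v h (?\<theta> h)) \<le> v i"
      using t by (auto simp: ir_rounds_def utility_past_def)
    then show ?thesis using step none buys no False by (auto simp: t_def)
  qed
qed

text \<open>A buyer pays \<open>p (T - d)\<close> exactly when the indicator of being above the
  threshold jumps from 0 to 1 between \<open>d\<close> and \<open>Suc d\<close>. The identity holds
  for every valuation profile, so all equilibria realize the same revenue.\<close>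

lemma realized_revenue:
  fixes E :: "real^'m^'m"
  assumes E: "\<And>k h. E $ k $ h \<ge> 0"
    and eq: "symmetric_equilibrium E n b T p \<sigma>"
    and v: "\<And>i. i < n \<Longrightarrow> v i \<in> {0..1}"
  defines "\<theta> \<equiv> threshold E p T (emp_tail n b v)"
  shows "(\<Sum>i<n. case outcome_of n b T \<sigma> v i of None \<Rightarrow> 0 | Some t \<Rightarrow> p t) / real n =
    (\<Sum>d<T. p (T - d) * (\<Sum>k\<in>UNIV. emp_tail n b v k (\<theta> (Suc d) k) - emp_tail n b v k (\<theta> d k)))"
proof -
  have one: "(case outcome_of n b T \<sigma> v i of None \<Rightarrow> 0 | Some t \<Rightarrow> p t) =
      (\<Sum>d<T. p (T - d) * (of_bool (\<theta> (Suc d) (b i) \<le> v i) - of_bool (\<theta> d (b i) \<le> v i)))"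
    if i: "i < n" for i
  proof -
    have "(case play n b T \<sigma> v D i of None \<Rightarrow> 0 | Some t \<Rightarrow> p t) =
      (\<Sum>d<D. p (T - d) * (of_bool (\<theta> (Suc d) (b i) \<le> v i) - of_bool (\<theta> d (b i) \<le> v i)))"
      if "D \<le> T" for D
      using that
    proof (induction D)
      case (Suc D)
      have a: "play n b T \<sigma> v D i \<noteq> None \<longleftrightarrow> \<theta> D (b i) \<le> v i"
        and c: "play n b T \<sigma> v (Suc D) i \<noteq> None \<longleftrightarrow> \<theta> (Suc D) (b i) \<le> v i"
        using play_threshold[OF E eq, of v D i] play_threshold[OF E eq, of v "Suc D" i] v i Suc.prems
        unfolding \<theta>_def by auto
      show ?case
      proof (cases "play n b T \<sigma> v D i")
        case None
        then show ?thesis using a c Suc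
          by (auto simp del: threshold.simps simp: Suc.IH[symmetric] split: if_splits)
      next
        case (Some s)
        then show ?thesis using a c Suc by (simp del: threshold.simps)
      qed
    qed simp
    then show ?thesis by (simp add: outcome_of_def)
  qed
  have count: "(\<Sum>i<n. of_bool (\<theta> d (b i) \<le> v i)) / real n = (\<Sum>k\<in>UNIV. emp_tail n b v k (\<theta> d k))" for d
    using sum_emp_tail[of "\<lambda>_. 1" n b v "\<theta> d"] by (simp only: mult_1_left sum_divide_distrib times_divide_eq_left)
  define a where "a d i = (of_bool (\<theta> d (b i) \<le> v i) :: real)" for d i
  have "(\<Sum>i<n. case outcome_of n b T \<sigma> v i of None \<Rightarrow> 0 | Some t \<Rightarrow> p t) / real n =
      (\<Sum>i<n. \<Sum>d<T. p (T - d) * (a (Suc d) i - a d i)) / real n"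
    unfolding a_def using one by (intro arg_cong2[of _ _ _ _ "(/)"] sum.cong) auto
  also have "\<dots> = (\<Sum>d<T. \<Sum>i<n. p (T - d) * (a (Suc d) i - a d i)) / real n"
    by (subst sum.swap) (rule refl)
  also have "\<dots> = (\<Sum>d<T. p (T - d) * ((\<Sum>i<n. a (Suc d) i) / real n - (\<Sum>i<n. a d i) / real n))"
    by (simp only: sum_distrib_left[symmetric] sum_subtractf diff_divide_distrib[symmetric]
        times_divide_eq_right sum_divide_distrib[symmetric])
  finally show ?thesis unfolding a_def count sum_subtractf .
qed

section \<open>Optimal prices in the limit recursion\<close>

lemma unif_tail_range: "0 \<le> unif_tail \<theta>" "unif_tail \<theta> \<le> 1"
  by (auto simp: unif_tail_def)

lemma unif_tail_min: "unif_tail (min x y) = max (unif_tail x) (unif_tail y)"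
  by (auto simp: unif_tail_def)

text \<open>
  The induction keeps the number \<open>c\<close> of candidate rounds already played, and bounds what any
  remaining price could still sell at once by \<open>max 0 (1 - p r) * \<beta> c k\<close>.  Counting only candidate
  rounds matters because \<open>\<beta>\<close> is decreasing.
\<close>

lemma block_revenue_le:
  fixes m :: "'m::finite \<Rightarrow> 'm \<Rightarrow> real"
  assumes m: "\<And>k h. 0 \<le> m k h" "\<And>k. (\<Sum>h\<in>UNIV. m k h) \<le> 1"
    and \<beta>_0: "\<And>k. \<beta> 0 k = 1" and \<beta>_Suc: "\<And>i k. \<beta> (Suc i) k = (\<Sum>h\<in>UNIV. m k h * \<beta> i h)"
    and y_0: "\<And>k. y 0 k = 0"
    and y_Suc: "\<And>d k. y (Suc d) k =
      (if candidate p (T - d) then max (y d k) (unif_tail (p (T - d) - (\<Sum>h\<in>UNIV. m k h * y d h)))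
       else y d k)"
  shows "(\<Sum>d<T. p (T - d) * (y (Suc d) k - y d k)) \<le> 1/4 * (\<Sum>i<T. \<beta> i k)"
proof -
  have \<beta>: "0 \<le> \<beta> i k \<and> \<beta> i k \<le> 1" for i k
  proof (induction i arbitrary: k)
    case (Suc i)
    have "(\<Sum>h\<in>UNIV. m k h * \<beta> i h) \<le> (\<Sum>h\<in>UNIV. m k h)"
      using Suc m by (intro sum_mono) (auto intro: mult_left_le)
    then show ?case using Suc m by (auto simp: \<beta>_Suc intro!: sum_nonneg intro: order_trans[OF _ m(2)])
  qed (simp add: \<beta>_0)
  have y: "0 \<le> y d k" for d k
    by (induction d) (auto simp: y_0 y_Suc le_max_iff_disj)
  have "\<exists>c\<le>d. (\<forall>k. (\<Sum>e<d. p (T - e) * (y (Suc e) k - y e k)) \<le> 1/4 * (\<Sum>i<c. \<beta> i k)) \<and>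
    (\<forall>r\<in>{1..T - d}. \<forall>k. unif_tail (p r - (\<Sum>h\<in>UNIV. m k h * y d h)) - y d k \<le> max 0 (1 - p r) * \<beta> c k)"
    if "d \<le> T" for d
    using that
  proof (induction d)
    case 0
    then show ?case by (intro exI[of _ 0]) (auto simp: \<beta>_0 y_0 unif_tail_def)
  next
    case (Suc d)
    define t where "t = T - d"
    obtain c where c: "c \<le> d"
      and rev: "\<And>k. (\<Sum>e<d. p (T - e) * (y (Suc e) k - y e k)) \<le> 1/4 * (\<Sum>i<c. \<beta> i k)"
      and jump: "\<And>r k. r \<in> {1..t} \<Longrightarrow>
        unif_tail (p r - (\<Sum>h\<in>UNIV. m k h * y d h)) - y d k \<le> max 0 (1 - p r) * \<beta> c k"
      using Suc by (auto simp: t_def)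
    show ?case
    proof (cases "candidate p t")
      case False
      then have "y (Suc d) = y d" by (auto simp: y_Suc t_def)
      then show ?thesis using c rev jump by (intro exI[of _ c]) (auto simp: t_def)
    next
      case True
      define g where "g k = y (Suc d) k - y d k" for k
      define P where "P = max 0 (1 - p t)"
      have y': "y (Suc d) k = max (y d k) (unif_tail (p t - (\<Sum>h\<in>UNIV. m k h * y d h)))" for k
        using True by (simp add: y_Suc t_def)
      have t: "t \<in> {1..t}" using Suc.prems by (auto simp: t_def)
      have g: "0 \<le> g k" "g k \<le> P * \<beta> c k" for k
        using jump[OF t, of k] \<beta>[of c k] by (auto simp: g_def y' P_def max_def)
      \<comment> \<open>The factor 1/4 is the maximum of \<open>p * (1 - p)\<close>. A nonpositive
        price earns nothing because \<open>g\<close> is nonnegative.\<close>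
      have gain: "p t * g k \<le> 1/4 * \<beta> c k" for k
      proof (cases "p t \<le> 0")
        case True
        then have "p t * g k \<le> 0" using g(1) by (rule mult_nonpos_nonneg)
        also have "0 \<le> 1/4 * \<beta> c k" using \<beta> by simp
        finally show ?thesis .
      next
        case False
        have "0 \<le> (p t - 1/2)\<^sup>2" by simp
        then have "p t * P \<le> 1/4" by (auto simp: P_def max_def power2_eq_square algebra_simps)
        then have "(p t * P) * \<beta> c k \<le> 1/4 * \<beta> c k" using \<beta> by (intro mult_right_mono) auto
        moreover have "p t * g k \<le> p t * (P * \<beta> c k)" using False g(2) by (intro mult_left_mono) auto
        ultimately show ?thesis by (simp add: mult.assoc)
      qed
      have "unif_tail (p r - (\<Sum>h\<in>UNIV. m k h * y (Suc d) h)) - y (Suc d) k \<le> max 0 (1 - p r) * \<beta> (Suc c) k"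
        if r: "r \<in> {1..T - Suc d}" for r k
      proof -
        have pr: "p t \<le> p r" using True r by (auto simp: candidate_def t_def)
        let ?e = "\<Sum>h\<in>UNIV. m k h * y d h" and ?e' = "\<Sum>h\<in>UNIV. m k h * y (Suc d) h"
        have "?e' - ?e = (\<Sum>h\<in>UNIV. m k h * g h)"
          by (simp add: g_def sum_subtractf right_diff_distrib)
        also have "\<dots> \<le> (\<Sum>h\<in>UNIV. m k h * (P * \<beta> c h))"
          using g m by (intro sum_mono mult_left_mono) auto
        also have "\<dots> = P * \<beta> (Suc c) k" by (simp add: \<beta>_Suc sum_distrib_left mult.left_commute)
        finally have e': "?e' - ?e \<le> P * \<beta> (Suc c) k" .
        have rhs: "0 \<le> max 0 (1 - p r) * \<beta> (Suc c) k" using \<beta> by simp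
        \<comment> \<open>The price rise, nonnegative because \<open>t\<close> is a candidate, is
          subtracted in full; as \<open>\<beta> \<le> 1\<close>, this is at least its multiple by
          \<open>\<beta> (Suc c) k\<close>. What is left of \<open>P\<close> is at most
          \<open>max 0 (1 - p r)\<close>.\<close>
        have "(p r - p t) * \<beta> (Suc c) k \<le> p r - p t" using \<beta> pr by (intro mult_left_le) auto
        moreover have "(P - (p r - p t)) * \<beta> (Suc c) k \<le> max 0 (1 - p r) * \<beta> (Suc c) k"
          using \<beta> pr by (intro mult_right_mono) (auto simp: P_def)
        ultimately have "P * \<beta> (Suc c) k - (p r - p t) \<le> max 0 (1 - p r) * \<beta> (Suc c) k"
          by (simp add: algebra_simps)
        then have key: "(1 - p r + ?e') - (1 - p t + ?e) \<le> max 0 (1 - p r) * \<beta> (Suc c) k"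
          using e' by linarith
        \<comment> \<open>Clipping does no harm: either block \<open>k\<close> is already sold out,
          or \<open>y (Suc d) k\<close> is at least the unclipped tail at \<open>p t\<close>, and
          \<open>key\<close> compares the unclipped tails.\<close>
        have "unif_tail (p r - ?e') \<le> max 0 (1 - p r + ?e')" "unif_tail (p r - ?e') \<le> 1"
          by (auto simp: unif_tail_def)
        moreover have "1 \<le> y (Suc d) k \<or> 1 - p t + ?e \<le> y (Suc d) k"
          unfolding y' by (auto simp: unif_tail_def)
        ultimately show ?thesis using key rhs y[of "Suc d" k] by linarith
      qed
      moreover have "(\<Sum>e<Suc d. p (T - e) * (y (Suc e) k - y e k)) \<le> 1/4 * (\<Sum>i<Suc c. \<beta> i k)" for k
        using rev[of k] gain[of k] by (simp add: t_def g_def)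
      ultimately show ?thesis using c by (intro exI[of _ "Suc c"]) (auto simp: t_def)
    qed
  qed
  from this[of T] obtain c where "c \<le> T"
    "(\<Sum>e<T. p (T - e) * (y (Suc e) k - y e k)) \<le> 1/4 * (\<Sum>i<c. \<beta> i k)" by auto
  \<comment> \<open>Passing from the \<open>c\<close> candidate rounds to all \<open>T\<close>
    rounds only adds nonnegative terms.\<close>
  moreover have "(\<Sum>i<c. \<beta> i k) \<le> (\<Sum>i<T. \<beta> i k)"
    using \<open>c \<le> T\<close> \<beta> by (intro sum_mono2) auto
  ultimately show ?thesis by linarith
qed

text \<open>Without clipping the recursion is affine, and its iterates are the partial Neumann sums
  of \<open>m\<close> applied to the constant 1/2. They increase because \<open>\<beta>\<close> is
  nonnegative, so \<open>le\<close>, which bounds the last one, keeps all of them in the unit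
  interval, where clipping does not act.\<close>

lemma constant_half_sales:
  fixes m :: "'m::finite \<Rightarrow> 'm \<Rightarrow> real"
  assumes m: "\<And>k h. 0 \<le> m k h"
    and \<beta>_0: "\<And>k. \<beta> 0 k = 1" and \<beta>_Suc: "\<And>i k. \<beta> (Suc i) k = (\<Sum>h\<in>UNIV. m k h * \<beta> i h)"
    and y_0: "\<And>k. y 0 k = 0"
    and y_Suc: "\<And>d k. y (Suc d) k = max (y d k) (unif_tail (1/2 - (\<Sum>h\<in>UNIV. m k h * y d h)))"
    and le: "\<And>k. 1/2 * (\<Sum>i<T. \<beta> i k) \<le> 1"
    and d: "d \<le> T"
  shows "y d k = 1/2 * (\<Sum>i<d. \<beta> i k)"
  using d
proof (induction d arbitrary: k)
  case (Suc d)
  have \<beta>: "0 \<le> \<beta> i k" for i k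
    by (induction i arbitrary: k) (auto simp: \<beta>_0 \<beta>_Suc m intro!: sum_nonneg)
  have "(\<Sum>h\<in>UNIV. m k h * y d h) = (\<Sum>h\<in>UNIV. \<Sum>i<d. 1/2 * (m k h * \<beta> i h))"
    using Suc by (simp add: sum_distrib_left algebra_simps)
  also have "\<dots> = (\<Sum>i<d. \<Sum>h\<in>UNIV. 1/2 * (m k h * \<beta> i h))" by (rule sum.swap)
  also have "\<dots> = 1/2 * (\<Sum>i<d. \<beta> (Suc i) k)" by (simp add: \<beta>_Suc sum_distrib_left)
  \<comment> \<open>The direct demand 1/2 supplies the term \<open>i = 0\<close>; applying
    \<open>m\<close> shifts the other terms by one.\<close>
  finally have e: "1/2 + (\<Sum>h\<in>UNIV. m k h * y d h) = 1/2 * (\<Sum>i<Suc d. \<beta> i k)"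
    by (simp only: sum.lessThan_Suc_shift \<beta>_0) (simp add: algebra_simps)
  have "(\<Sum>i<Suc d. \<beta> i k) \<le> (\<Sum>i<T. \<beta> i k)"
    using Suc.prems \<beta> by (intro sum_mono2) auto
  then have "1/2 * (\<Sum>i<Suc d. \<beta> i k) \<le> 1" using le[of k] by linarith
  moreover have "0 \<le> (\<Sum>i<d. \<beta> i k)" using \<beta> by (simp add: sum_nonneg)
  ultimately have t: "unif_tail (1/2 - (\<Sum>h\<in>UNIV. m k h * y d h)) = 1/2 * (\<Sum>i<Suc d. \<beta> i k)"
    using e \<beta>[of d k] by (simp add: unif_tail_def)
  have "y d k \<le> 1/2 * (\<Sum>i<Suc d. \<beta> i k)" using Suc \<beta>[of d k] by simp
  then show ?case by (simp only: y_Suc[of d k] t max_absorb2)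
qed (simp add: y_0)

section \<open>Convergence of the thresholds\<close>

abbreviation uniform01 :: "real measure" where
  "uniform01 \<equiv> restrict_space lborel {0..1}"

abbreviation valuations :: "nat \<Rightarrow> (nat \<Rightarrow> real) measure" where
  "valuations n \<equiv> \<Pi>\<^sub>M i\<in>{..<n}. uniform01"

lemma prob_space_uniform01: "prob_space uniform01"
  by (rule prob_space_restrict_space) auto

lemma prob_space_valuations: "prob_space (valuations n)"
  by (rule prob_space_PiM) (rule prob_space_uniform01)

lemma product_sigma_finite_uniform01: "product_sigma_finite (\<lambda>i::nat. uniform01)"
  by (intro product_sigma_finite.intro prob_space_imp_sigma_finite prob_space_uniform01)

lemma measurable_valuation [measurable]:
  "i < n \<Longrightarrow> (\<lambda>v. v i) \<in> borel_measurable (valuations n)"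
proof -
  assume "i < n"
  then have "(\<lambda>v. v i) \<in> measurable (valuations n) uniform01"
    by (intro measurable_component_singleton) auto
  moreover have "id \<in> borel_measurable uniform01"
    by (intro measurable_restrict_space1) auto
  ultimately have "id \<circ> (\<lambda>v. v i) \<in> borel_measurable (valuations n)"
    by (rule measurable_comp)
  then show ?thesis by (simp add: comp_def)
qed

lemma integral_unif_tail: "(\<integral>w. of_bool (\<theta> \<le> w) \<partial>uniform01) = unif_tail \<theta>"
proof -
  have "(\<integral>w. of_bool (\<theta> \<le> w) \<partial>uniform01) = (\<integral>w. (indicator {max 0 \<theta>..1} w :: real) \<partial>lborel)"
    by (subst integral_restrict_space, simp) (rule Bochner_Integration.integral_cong, auto simp: indicator_def)
  also have "\<dots> = measure lborel {max 0 \<theta>..1}" by simp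
  also have "\<dots> = unif_tail \<theta>" by (cases "max 0 \<theta> \<le> 1") (auto simp: unif_tail_def)
  finally show ?thesis .
qed

text \<open>Independence and centring make the mixed terms vanish, and each of the \<open>n\<close>
  squares contributes at most 1.\<close>

lemma second_moment_sum_le:
  fixes f :: "nat \<Rightarrow> real \<Rightarrow> real"
  assumes meas [measurable]: "\<And>i. f i \<in> borel_measurable borel"
    and bound: "\<And>i w. \<bar>f i w\<bar> \<le> 1"
    and centered: "\<And>i. (\<integral>w. f i w \<partial>uniform01) = 0"
  shows "(\<integral>v. (\<Sum>i<n. f i (v i))\<^sup>2 \<partial>valuations n) \<le> real n"
proof -
  interpret product_sigma_finite "\<lambda>i::nat. uniform01" by (rule product_sigma_finite_uniform01)
  interpret V: prob_space "valuations n" by (rule prob_space_valuations)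
  interpret U: prob_space uniform01 by (rule prob_space_uniform01)
  have bound2: "\<bar>f i w * f j w'\<bar> \<le> 1" for i j w w'
    using bound by (simp add: abs_mult mult_le_one)
  have int: "integrable (valuations n) (\<lambda>v. f i (v i) * f j (v j))" if "i < n" "j < n" for i j
    using that by (intro V.integrable_const_bound[of _ 1]) (auto simp: bound2)
  have meas_f: "f i \<in> borel_measurable uniform01" for i
    by (intro measurable_restrict_space1) simp
  have cross: "(\<integral>v. f i (v i) * f j (v j) \<partial>valuations n) = 0" if "i < n" "j < n" "i \<noteq> j" for i j
  proof -
    \<comment> \<open>The product formula runs over all \<open>n\<close> coordinates, hence the
      constant factor 1 at every index other than \<open>i\<close> and \<open>j\<close>.\<close>
    let ?g = "\<lambda>l. if l = i then f i else if l = j then f j else (\<lambda>_. 1)"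
    have "f i (v i) * f j (v j) = (\<Prod>l<n. ?g l (v l))" for v
      using that by (subst prod.remove[of _ i], simp, simp, subst prod.remove[of _ j])
        (auto intro!: prod.neutral)
    then have "(\<integral>v. f i (v i) * f j (v j) \<partial>valuations n) = (\<integral>v. (\<Prod>l<n. ?g l (v l)) \<partial>valuations n)"
      by simp
    also have "\<dots> = (\<Prod>l<n. \<integral>w. ?g l w \<partial>uniform01)"
      by (rule product_integral_prod)
        (auto intro!: U.integrable_const_bound[of _ 1] simp: bound meas_f)
    also have "\<dots> = 0" using that centered by (intro prod_zero) auto
    finally show ?thesis .
  qed
  have diag: "(\<integral>v. f i (v i) * f i (v i) \<partial>valuations n) \<le> 1" if "i < n" for i
  proof -
    have "(\<integral>v. f i (v i) * f i (v i) \<partial>valuations n) \<le> (\<integral>v. 1 \<partial>valuations n)"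
      using that int by (intro integral_mono abs_le_D1[OF bound2]) auto
    then show ?thesis by (simp add: V.prob_space)
  qed
  have "(\<integral>v. (\<Sum>i<n. f i (v i))\<^sup>2 \<partial>valuations n) =
      (\<integral>v. (\<Sum>i<n. \<Sum>j<n. f i (v i) * f j (v j)) \<partial>valuations n)"
    by (simp add: power2_eq_square sum_product)
  also have "\<dots> = (\<Sum>i<n. \<Sum>j<n. \<integral>v. f i (v i) * f j (v j) \<partial>valuations n)"
    using int by (subst Bochner_Integration.integral_sum)
      (auto intro!: sum.cong Bochner_Integration.integral_sum)
  also have "\<dots> = (\<Sum>i<n. \<integral>v. f i (v i) * f i (v i) \<partial>valuations n)"
  proof (intro sum.cong refl)
    fix i assume "i \<in> {..<n}"
    then show "(\<Sum>j<n. \<integral>v. f i (v i) * f j (v j) \<partial>valuations n) = (\<integral>v. f i (v i) * f i (v i) \<partial>valuations n)"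
      using cross by (subst sum.remove[of _ i]) auto
  qed
  also have "\<dots> \<le> (\<Sum>i<n. 1)" using diag by (intro sum_mono) auto
  finally show ?thesis by simp
qed

section \<open>Empirical tails and their law of large numbers\<close>

lemma emp_tail_range: "0 \<le> emp_tail n b v k \<theta>" "emp_tail n b v k \<theta> \<le> 1"
proof -
  show "0 \<le> emp_tail n b v k \<theta>" by (simp add: emp_tail_def)
  have "(\<Sum>i<n. of_bool (b i = k \<and> \<theta> \<le> v i)) \<le> (\<Sum>i<n. 1::real)" by (intro sum_mono) auto
  then show "emp_tail n b v k \<theta> \<le> 1" by (cases "n = 0") (auto simp: emp_tail_def)
qed

lemma abs_emp_tail_le: "\<bar>emp_tail n b v k \<theta>\<bar> \<le> 1"
  using emp_tail_range[of n b v k \<theta>] by simp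

lemma emp_tail_antimono: "\<theta> \<le> \<theta>' \<Longrightarrow> emp_tail n b v k \<theta>' \<le> emp_tail n b v k \<theta>"
  unfolding emp_tail_def by (intro divide_right_mono sum_mono) auto

lemma emp_tail_borel [measurable]:
  assumes [measurable]: "\<theta> \<in> borel_measurable (valuations n)"
  shows "(\<lambda>v. emp_tail n b v k (\<theta> v)) \<in> borel_measurable (valuations n)"
proof -
  have "(\<lambda>v. of_bool (b i = k \<and> \<theta> v \<le> v i) :: real) \<in> borel_measurable (valuations n)" if "i < n" for i
  proof -
    have "{v \<in> space (valuations n). \<theta> v \<le> v i} \<in> sets (valuations n)"
      using that by (intro borel_measurable_le assms measurable_valuation)
    then show ?thesis
      unfolding of_bool_def by (cases "b i = k") (auto intro!: measurable_If)
  qed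
  then show ?thesis
    unfolding emp_tail_def by (intro borel_measurable_divide borel_measurable_sum borel_measurable_const) auto
qed

lemma integrable_emp_tail:
  assumes "\<theta> \<in> borel_measurable (valuations n)"
  shows "integrable (valuations n) (\<lambda>v. emp_tail n b v k (\<theta> v))"
proof -
  interpret prob_space "valuations n" by (rule prob_space_valuations)
  show ?thesis
    using assms by (intro integrable_const_bound[of _ 1] emp_tail_borel) (auto simp: abs_emp_tail_le)
qed

text \<open>The centred count has second moment at most \<open>n\<close>, so after division by
  \<open>n\<close> it is at most \<open>1/n\<close>; nonnegativity of the variance then bounds the
  first absolute moment by the square root.\<close>

lemma emp_tail_deviation:
  "(\<integral>v. \<bar>emp_tail n b v k \<theta> - real (card {i. i < n \<and> b i = k}) / real n * unif_tail \<theta>\<bar> \<partial>valuations n)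
    \<le> 1 / sqrt (real n)"
proof (cases "n = 0")
  \<comment> \<open>Division by zero makes both sides 0 here.\<close>
  case True
  then show ?thesis by (simp add: emp_tail_def)
next
  case False
  interpret prob_space "valuations n" by (rule prob_space_valuations)
  interpret U: prob_space uniform01 by (rule prob_space_uniform01)
  \<comment> \<open>Buyers outside block \<open>k\<close> contribute 0, so that the sum can run over
    all \<open>n\<close> independent valuations.\<close>
  define f where "f i w = (if b i = k then of_bool (\<theta> \<le> w) - unif_tail \<theta> else 0)" for i w
  define Y where "Y v = emp_tail n b v k \<theta> - real (card {i. i < n \<and> b i = k}) / real n * unif_tail \<theta>" for v
  have meas: "(\<lambda>w. of_bool (\<theta> \<le> w) :: real) \<in> borel_measurable borel"
    unfolding of_bool_def by measurable
  have sum: "(\<integral>v. (\<Sum>i<n. f i (v i))\<^sup>2 \<partial>valuations n) \<le> real n"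
  proof (rule second_moment_sum_le)
    show "f i \<in> borel_measurable borel" for i
      unfolding f_def using meas by (cases "b i = k") auto
    show "\<bar>f i w\<bar> \<le> 1" for i w
      using unif_tail_range[of \<theta>] by (auto simp: f_def)
    show "(\<integral>w. f i w \<partial>uniform01) = 0" for i
    proof (cases "b i = k")
      case True
      have "integrable uniform01 (\<lambda>w. of_bool (\<theta> \<le> w) :: real)"
        by (intro U.integrable_const_bound[of _ 1] measurable_restrict_space1 meas) auto
      then show ?thesis using True U.prob_space by (simp add: f_def integral_unif_tail)
    qed (simp add: f_def)
  qed
  have Y_eq: "Y v = (\<Sum>i<n. f i (v i)) / real n" for v
  proof -
    have "(\<Sum>i<n. f i (v i)) = (\<Sum>i<n. of_bool (b i = k \<and> \<theta> \<le> v i) - of_bool (b i = k) * unif_tail \<theta>)"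
      by (intro sum.cong) (auto simp: f_def)
    also have "\<dots> = (\<Sum>i<n. of_bool (b i = k \<and> \<theta> \<le> v i)) - (\<Sum>i<n. of_bool (b i = k)) * unif_tail \<theta>"
      by (simp only: sum_subtractf sum_distrib_right)
    also have "(\<Sum>i<n. of_bool (b i = k)) = real (card {i. i < n \<and> b i = k})"
      by (simp add: Collect_conj_eq lessThan_def)
    finally show ?thesis by (simp only: Y_def emp_tail_def diff_divide_distrib times_divide_eq_left)
  qed
  have "expectation (\<lambda>v. (Y v)\<^sup>2) = expectation (\<lambda>v. (\<Sum>i<n. f i (v i))\<^sup>2) / (real n)\<^sup>2"
    unfolding Y_eq power_divide by simp
  then have "expectation (\<lambda>v. (Y v)\<^sup>2) \<le> real n / (real n)\<^sup>2"
    using sum by (simp add: divide_right_mono)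
  then have second: "expectation (\<lambda>v. (Y v)\<^sup>2) \<le> 1 / real n"
    using False by (simp add: power2_eq_square)
  have Y [measurable]: "Y \<in> borel_measurable (valuations n)"
    unfolding Y_def by measurable
  have Y_le: "\<bar>Y v\<bar> \<le> 2" for v
  proof -
    have "card {i. i < n \<and> b i = k} \<le> card {..<n}" by (intro card_mono) auto
    then have "real (card {i. i < n \<and> b i = k}) / real n \<le> 1" using False by simp
    then have "real (card {i. i < n \<and> b i = k}) / real n * unif_tail \<theta> \<le> 1"
      by (rule mult_le_one[OF _ unif_tail_range])
    moreover have "0 \<le> real (card {i. i < n \<and> b i = k}) / real n * unif_tail \<theta>"
      by (intro mult_nonneg_nonneg unif_tail_range) auto
    ultimately show ?thesis
      using emp_tail_range[of n b v k \<theta>] unfolding Y_def by linarith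
  qed
  have "integrable (valuations n) (\<lambda>v. \<bar>Y v\<bar>)"
    using Y_le by (intro integrable_const_bound[of _ 2]) auto
  moreover have "integrable (valuations n) (\<lambda>v. \<bar>Y v\<bar>\<^sup>2)"
    using power_mono[OF Y_le, where n = 2] by (intro integrable_const_bound[of _ 4]) auto
  ultimately have "(expectation (\<lambda>v. \<bar>Y v\<bar>))\<^sup>2 \<le> expectation (\<lambda>v. \<bar>Y v\<bar>\<^sup>2)"
    using variance_eq[of "\<lambda>v. \<bar>Y v\<bar>"] variance_positive[of "\<lambda>v. \<bar>Y v\<bar>"] by simp
  then have "(expectation (\<lambda>v. \<bar>Y v\<bar>))\<^sup>2 \<le> 1 / real n" using second by simp
  then have "expectation (\<lambda>v. \<bar>Y v\<bar>) \<le> sqrt (1 / real n)" by (rule real_le_rsqrt)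
  then show ?thesis by (simp add: Y_def real_sqrt_divide)
qed

text \<open>The triangle inequality separates the random fluctuation, at most
  \<open>1 / sqrt n\<close>, from the deterministic error of the block share, which is weighted by a
  tail of at most 1.\<close>

lemma emp_tail_L1_fixed:
  assumes N: "filterlim N at_top sequentially"
    and sizes: "(\<lambda>r. real (card {i. i < N r \<and> b r i = k}) / real (N r)) \<longlonglongrightarrow> a"
  shows "(\<lambda>r. \<integral>v. \<bar>emp_tail (N r) (b r) v k \<theta> - a * unif_tail \<theta>\<bar> \<partial>valuations (N r)) \<longlonglongrightarrow> 0"
proof (rule tendsto_sandwich)
  let ?c = "\<lambda>r. real (card {i. i < N r \<and> b r i = k}) / real (N r)"
  show "\<forall>\<^sub>F r in sequentially. 0 \<le> (\<integral>v. \<bar>emp_tail (N r) (b r) v k \<theta> - a * unif_tail \<theta>\<bar> \<partial>valuations (N r))"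
    by (intro always_eventually allI integral_nonneg_AE) auto
  have "filterlim (\<lambda>r. sqrt (real (N r))) at_top sequentially"
    by (intro filterlim_compose[OF sqrt_at_top] filterlim_compose[OF filterlim_real_sequentially] N)
  then have "(\<lambda>r. 1 / sqrt (real (N r))) \<longlonglongrightarrow> 0"
    using filterlim_at_top_imp_at_infinity
    by (intro tendsto_divide_0[OF tendsto_const]) blast
  moreover have "(\<lambda>r. \<bar>?c r - a\<bar>) \<longlonglongrightarrow> 0"
    using sizes by (intro tendsto_rabs_zero) (simp add: LIM_zero)
  ultimately show "(\<lambda>r. 1 / sqrt (real (N r)) + \<bar>?c r - a\<bar>) \<longlonglongrightarrow> 0"
    using tendsto_add by fastforce
  show "\<forall>\<^sub>F r in sequentially.
      (\<integral>v. \<bar>emp_tail (N r) (b r) v k \<theta> - a * unif_tail \<theta>\<bar> \<partial>valuations (N r)) \<le> 1 / sqrt (real (N r)) + \<bar>?c r - a\<bar>"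
  proof (intro always_eventually allI)
    fix r
    interpret prob_space "valuations (N r)" by (rule prob_space_valuations)
    have int: "integrable (valuations (N r)) (\<lambda>v. \<bar>emp_tail (N r) (b r) v k \<theta> - c\<bar>)" for c
      by (intro integrable_abs Bochner_Integration.integrable_diff integrable_emp_tail) auto
    define c where "c = ?c r"
    have "\<bar>emp_tail (N r) (b r) v k \<theta> - a * unif_tail \<theta>\<bar> \<le>
        \<bar>emp_tail (N r) (b r) v k \<theta> - c * unif_tail \<theta>\<bar> + \<bar>c - a\<bar>" for v
    proof -
      have "\<bar>c * unif_tail \<theta> - a * unif_tail \<theta>\<bar> = \<bar>c - a\<bar> * unif_tail \<theta>"
        by (simp only: left_diff_distrib[symmetric] abs_mult abs_of_nonneg[OF unif_tail_range(1)])
      also have "\<dots> \<le> \<bar>c - a\<bar>" using unif_tail_range[of \<theta>] by (intro mult_left_le) auto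
      finally show ?thesis by linarith
    qed
    then have "expectation (\<lambda>v. \<bar>emp_tail (N r) (b r) v k \<theta> - a * unif_tail \<theta>\<bar>) \<le>
        expectation (\<lambda>v. \<bar>emp_tail (N r) (b r) v k \<theta> - c * unif_tail \<theta>\<bar> + \<bar>c - a\<bar>)"
      by (intro integral_mono int Bochner_Integration.integrable_add) auto
    also have "\<dots> = expectation (\<lambda>v. \<bar>emp_tail (N r) (b r) v k \<theta> - c * unif_tail \<theta>\<bar>) + \<bar>c - a\<bar>"
      by (subst Bochner_Integration.integral_add) (auto simp: int prob_space)
    also have "\<dots> \<le> 1 / sqrt (real (N r)) + \<bar>c - a\<bar>"
      using emp_tail_deviation unfolding c_def by simp
    finally show "expectation (\<lambda>v. \<bar>emp_tail (N r) (b r) v k \<theta> - a * unif_tail \<theta>\<bar>) \<le> 1 / sqrt (real (N r)) + \<bar>?c r - a\<bar>"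
      by (simp only: c_def)
  qed
qed simp

text \<open>
  Monotonicity of the tails replaces a uniform law of large numbers: unless \<open>\<Theta>\<close> is more than \<open>\<delta>\<close>
  away from \<open>\<theta>\<close>, its empirical tail lies between those at \<open>\<theta> - \<delta>\<close> and \<open>\<theta> + \<delta>\<close>.
\<close>

lemma emp_tail_L1_random:
  fixes \<Theta> :: "nat \<Rightarrow> (nat \<Rightarrow> real) \<Rightarrow> real"
  assumes N: "filterlim N at_top sequentially"
    and sizes: "(\<lambda>r. real (card {i. i < N r \<and> b r i = k}) / real (N r)) \<longlonglongrightarrow> a"
    and a: "0 \<le> a" "a \<le> 1"
    and int: "\<And>r. integrable (valuations (N r)) (\<Theta> r)"
    and lim: "(\<lambda>r. \<integral>v. \<bar>\<Theta> r v - \<theta>\<bar> \<partial>valuations (N r)) \<longlonglongrightarrow> 0"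
  shows "(\<lambda>r. \<integral>v. \<bar>emp_tail (N r) (b r) v k (\<Theta> r v) - a * unif_tail \<theta>\<bar> \<partial>valuations (N r)) \<longlonglongrightarrow> 0"
proof (rule LIMSEQ_I)
  define D where "D r x = (\<integral>v. \<bar>emp_tail (N r) (b r) v k x - a * unif_tail x\<bar> \<partial>valuations (N r))" for r x
  define I where "I r = (\<integral>v. \<bar>\<Theta> r v - \<theta>\<bar> \<partial>valuations (N r))" for r
  let ?Z = "\<lambda>r. \<integral>v. \<bar>emp_tail (N r) (b r) v k (\<Theta> r v) - a * unif_tail \<theta>\<bar> \<partial>valuations (N r)"
  fix \<epsilon> :: real assume "0 < \<epsilon>"
  \<comment> \<open>The bound \<open>le\<close> below tends to \<open>\<delta>\<close>, which
    therefore has to stay strictly below \<open>\<epsilon>\<close>.\<close>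
  define \<delta> where "\<delta> = \<epsilon> / 2"
  have \<delta>: "0 < \<delta>" "\<delta> < \<epsilon>" using \<open>0 < \<epsilon>\<close> by (auto simp: \<delta>_def)
  have le: "?Z r \<le> D r (\<theta> - \<delta>) + D r (\<theta> + \<delta>) + \<delta> + I r / \<delta>" for r
  proof -
    interpret prob_space "valuations (N r)" by (rule prob_space_valuations)
    let ?F = "\<lambda>v x. emp_tail (N r) (b r) v k x" and ?G = "\<lambda>x. a * unif_tail x"
    have G: "\<bar>?G x - ?G y\<bar> \<le> \<bar>x - y\<bar>" for x y
    proof -
      have "\<bar>?G x - ?G y\<bar> = a * \<bar>unif_tail x - unif_tail y\<bar>"
        using a by (simp add: right_diff_distrib[symmetric] abs_mult)
      also have "\<dots> \<le> 1 * \<bar>x - y\<bar>"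
        using a by (intro mult_mono) (auto simp: unif_tail_def)
      finally show ?thesis by simp
    qed
    have G01: "0 \<le> ?G x \<and> ?G x \<le> 1" for x
      using a unif_tail_range[of x] by (auto intro: mult_le_one)
    have point: "\<bar>?F v (\<Theta> r v) - ?G \<theta>\<bar> \<le>
        \<bar>?F v (\<theta> - \<delta>) - ?G (\<theta> - \<delta>)\<bar> + \<bar>?F v (\<theta> + \<delta>) - ?G (\<theta> + \<delta>)\<bar> + \<delta> + \<bar>\<Theta> r v - \<theta>\<bar> / \<delta>" for v
    proof (cases "\<bar>\<Theta> r v - \<theta>\<bar> \<le> \<delta>")
      case True
      then have "?F v (\<theta> + \<delta>) \<le> ?F v (\<Theta> r v)" "?F v (\<Theta> r v) \<le> ?F v (\<theta> - \<delta>)"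
        by (auto intro!: emp_tail_antimono)
      moreover have "0 \<le> \<bar>\<Theta> r v - \<theta>\<bar> / \<delta>" using \<delta> by simp
      moreover have "\<bar>?G (\<theta> - \<delta>) - ?G \<theta>\<bar> \<le> \<delta>" "\<bar>?G (\<theta> + \<delta>) - ?G \<theta>\<bar> \<le> \<delta>"
        using G[of "\<theta> - \<delta>" \<theta>] G[of "\<theta> + \<delta>" \<theta>] \<delta> by auto
      ultimately show ?thesis by linarith
    next
      case False
      \<comment> \<open>Markov's inequality in pointwise form: both tails lie in the unit interval,
        so they differ by at most 1.\<close>
      then have "1 \<le> \<bar>\<Theta> r v - \<theta>\<bar> / \<delta>" using \<delta> by simp
      moreover have "\<bar>?F v (\<Theta> r v) - ?G \<theta>\<bar> \<le> 1"
        using emp_tail_range[of "N r" "b r" v k "\<Theta> r v"] G01[of \<theta>] by linarith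
      ultimately show ?thesis using \<delta> by linarith
    qed
    have meas: "\<Theta> r \<in> borel_measurable (valuations (N r))" using int by auto
    have i1: "integrable (valuations (N r)) (\<lambda>v. \<bar>?F v x - c\<bar>)" for x c
      by (intro integrable_abs Bochner_Integration.integrable_diff integrable_emp_tail) auto
    have i2: "integrable (valuations (N r)) (\<lambda>v. \<bar>?F v (\<Theta> r v) - c\<bar>)" for c
      by (intro integrable_abs Bochner_Integration.integrable_diff integrable_emp_tail meas) auto
    have i3: "integrable (valuations (N r)) (\<lambda>v. \<bar>\<Theta> r v - \<theta>\<bar> / \<delta>)"
      using int by auto
    have "?Z r \<le> expectation (\<lambda>v. \<bar>?F v (\<theta> - \<delta>) - ?G (\<theta> - \<delta>)\<bar> + \<bar>?F v (\<theta> + \<delta>) - ?G (\<theta> + \<delta>)\<bar> + \<delta> + \<bar>\<Theta> r v - \<theta>\<bar> / \<delta>)"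
      by (intro integral_mono point i1 i2 i3 Bochner_Integration.integrable_add integrable_const)
    also have "\<dots> = D r (\<theta> - \<delta>) + D r (\<theta> + \<delta>) + \<delta> + I r / \<delta>"
      using i1 i3 by (simp add: D_def I_def prob_space)
    finally show ?thesis .
  qed
  have "(\<lambda>r. D r (\<theta> - \<delta>) + D r (\<theta> + \<delta>) + \<delta> + I r / \<delta>) \<longlonglongrightarrow> 0 + 0 + \<delta> + 0 / \<delta>"
    unfolding D_def I_def using emp_tail_L1_fixed[OF N sizes] lim \<delta>
    by (intro tendsto_add tendsto_divide tendsto_const) auto
  then have "\<forall>\<^sub>F r in sequentially. D r (\<theta> - \<delta>) + D r (\<theta> + \<delta>) + \<delta> + I r / \<delta> < \<epsilon>"
    using \<delta> by (intro order_tendstoD(2)) auto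
  then have "\<forall>\<^sub>F r in sequentially. norm (?Z r - 0) < \<epsilon>"
  proof (rule eventually_mono)
    fix r assume "D r (\<theta> - \<delta>) + D r (\<theta> + \<delta>) + \<delta> + I r / \<delta> < \<epsilon>"
    moreover have "0 \<le> ?Z r" by (intro integral_nonneg_AE) auto
    ultimately show "norm (?Z r - 0) < \<epsilon>" using le[of r] by simp
  qed
  then show "\<exists>r0. \<forall>r\<ge>r0. norm (?Z r - 0) < \<epsilon>" by (simp add: eventually_sequentially)
qed

section \<open>Random thresholds and expected revenue in the limit\<close>

lemma integrable_threshold:
  fixes E :: "real^'m^'m"
  shows "integrable (valuations n) (\<lambda>v. threshold E p T (emp_tail n b v) d k)"
proof (induction d arbitrary: k)
  case 0
  interpret prob_space "valuations n" by (rule prob_space_valuations)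
  show ?case by simp
next
  case (Suc d)
  interpret prob_space "valuations n" by (rule prob_space_valuations)
  have "integrable (valuations n)
      (\<lambda>v. p (T - d) - (\<Sum>h\<in>UNIV. E $ k $ h * emp_tail n b v h (threshold E p T (emp_tail n b v) d h)))"
    using Suc by (intro Bochner_Integration.integrable_diff integrable_const
        Bochner_Integration.integrable_sum integrable_mult_right integrable_emp_tail) auto
  then show ?case using Suc by (cases "candidate p (T - d)") auto
qed

text \<open>Induction over the rounds: \<open>min\<close> changes by at most the sum of the changes
  of its arguments, so the new error is at most the old one plus the \<open>E\<close>-weighted
  errors of the tails. The thresholds depend on the same valuations as the tails, so these errors
  are controlled by \<open>emp_tail_L1_random\<close>.\<close>

lemma threshold_L1:
  fixes E :: "real^'m^'m" and a :: "'m \<Rightarrow> real" and p :: "nat \<Rightarrow> real" and T :: nat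
  assumes N: "filterlim N at_top sequentially"
    and sizes: "\<And>k. (\<lambda>r. real (card {i. i < N r \<and> b r i = k}) / real (N r)) \<longlonglongrightarrow> a k"
    and a: "\<And>k. 0 \<le> a k \<and> a k \<le> 1"
    and E: "\<And>k h. 0 \<le> E $ k $ h"
  defines "\<theta> \<equiv> threshold E p T (\<lambda>k x. a k * unif_tail x)"
  shows "(\<lambda>r. \<integral>v. \<bar>threshold E p T (emp_tail (N r) (b r) v) d k - \<theta> d k\<bar> \<partial>valuations (N r)) \<longlonglongrightarrow> 0"
proof (induction d arbitrary: k)
  case 0
  then show ?case by (simp add: \<theta>_def)
next
  case (Suc d)
  let ?\<Theta> = "\<lambda>r v. threshold E p T (emp_tail (N r) (b r) v)"
  let ?J = "\<lambda>r k. \<integral>v. \<bar>?\<Theta> r v d k - \<theta> d k\<bar> \<partial>valuations (N r)"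
  let ?K = "\<lambda>r h. \<integral>v. \<bar>emp_tail (N r) (b r) v h (?\<Theta> r v d h) - a h * unif_tail (\<theta> d h)\<bar> \<partial>valuations (N r)"
  have K: "(\<lambda>r. ?K r h) \<longlonglongrightarrow> 0" for h
    by (rule emp_tail_L1_random[OF N sizes _ _ integrable_threshold Suc]) (use a in auto)
  show ?case
  proof (cases "candidate p (T - d)")
    case False
    then show ?thesis using Suc by (simp add: \<theta>_def)
  next
    case True
    have le: "(\<integral>v. \<bar>?\<Theta> r v (Suc d) k - \<theta> (Suc d) k\<bar> \<partial>valuations (N r))
        \<le> ?J r k + (\<Sum>h\<in>UNIV. E $ k $ h * ?K r h)" for r
    proof -
      interpret prob_space "valuations (N r)" by (rule prob_space_valuations)
      note int = integrable_threshold[of "N r" E p T "b r"]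
      have i2: "integrable (valuations (N r)) (\<lambda>v. \<bar>emp_tail (N r) (b r) v h (?\<Theta> r v d h) - c\<bar>)" for h c
        using int[of d h] by (intro integrable_abs Bochner_Integration.integrable_diff integrable_emp_tail) auto
      have i1: "integrable (valuations (N r)) (\<lambda>v. \<bar>?\<Theta> r v d k - c\<bar>)" for d k c
        using int by (intro integrable_abs Bochner_Integration.integrable_diff) auto
      have point: "\<bar>?\<Theta> r v (Suc d) k - \<theta> (Suc d) k\<bar> \<le> \<bar>?\<Theta> r v d k - \<theta> d k\<bar> +
          (\<Sum>h\<in>UNIV. E $ k $ h * \<bar>emp_tail (N r) (b r) v h (?\<Theta> r v d h) - a h * unif_tail (\<theta> d h)\<bar>)" for v
      proof -
        let ?s = "\<Sum>h\<in>UNIV. E $ k $ h * emp_tail (N r) (b r) v h (?\<Theta> r v d h)"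
        let ?s' = "\<Sum>h\<in>UNIV. E $ k $ h * (a h * unif_tail (\<theta> d h))"
        have "\<bar>?s - ?s'\<bar> = \<bar>\<Sum>h\<in>UNIV. E $ k $ h * (emp_tail (N r) (b r) v h (?\<Theta> r v d h) - a h * unif_tail (\<theta> d h))\<bar>"
          by (simp add: sum_subtractf right_diff_distrib)
        also have "\<dots> \<le> (\<Sum>h\<in>UNIV. E $ k $ h * \<bar>emp_tail (N r) (b r) v h (?\<Theta> r v d h) - a h * unif_tail (\<theta> d h)\<bar>)"
          using E by (intro order_trans[OF sum_abs] sum_mono) (simp add: abs_mult)
        finally have "\<bar>?s - ?s'\<bar> \<le> \<dots>" .
        moreover have "?\<Theta> r v (Suc d) k = min (?\<Theta> r v d k) (p (T - d) - ?s)"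
          "\<theta> (Suc d) k = min (\<theta> d k) (p (T - d) - ?s')"
          using True by (auto simp: \<theta>_def)
        ultimately show ?thesis by linarith
      qed
      have "(\<integral>v. \<bar>?\<Theta> r v (Suc d) k - \<theta> (Suc d) k\<bar> \<partial>valuations (N r)) \<le>
        expectation (\<lambda>v. \<bar>?\<Theta> r v d k - \<theta> d k\<bar> +
          (\<Sum>h\<in>UNIV. E $ k $ h * \<bar>emp_tail (N r) (b r) v h (?\<Theta> r v d h) - a h * unif_tail (\<theta> d h)\<bar>))"
        by (intro integral_mono point i1 i2 Bochner_Integration.integrable_add
            Bochner_Integration.integrable_sum integrable_mult_right)
      also have "\<dots> = ?J r k + (\<Sum>h\<in>UNIV. E $ k $ h * ?K r h)"
        using i1 i2 by (subst Bochner_Integration.integral_add) (auto simp: Bochner_Integration.integral_sum)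
      finally show ?thesis .
    qed
    have "(\<lambda>r. ?J r k + (\<Sum>h\<in>UNIV. E $ k $ h * ?K r h)) \<longlonglongrightarrow> 0 + (\<Sum>h\<in>UNIV. E $ k $ h * 0)"
      by (intro tendsto_add tendsto_sum tendsto_mult tendsto_const Suc K)
    then have upper: "(\<lambda>r. ?J r k + (\<Sum>h\<in>UNIV. E $ k $ h * ?K r h)) \<longlonglongrightarrow> 0" by simp
    show ?thesis
      by (rule tendsto_sandwich[OF always_eventually always_eventually tendsto_const upper])
        (use le in \<open>auto intro!: integral_nonneg_AE\<close>)
  qed
qed

text \<open>By \<open>realized_revenue\<close> the revenue is a finite linear combination of
  empirical tails at random thresholds, whose \<open>L1\<close> convergence carries over to
  expectations.\<close>

lemma revenue_tendsto:
  fixes E :: "real^'m^'m" and a :: "'m \<Rightarrow> real"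
  assumes N: "filterlim N at_top sequentially"
    and sizes: "\<And>k. (\<lambda>r. real (card {i. i < N r \<and> b r i = k}) / real (N r)) \<longlonglongrightarrow> a k"
    and a: "\<And>k. 0 \<le> a k \<and> a k \<le> 1"
    and E: "\<And>k h. 0 \<le> E $ k $ h"
    and eq: "\<And>r. symmetric_equilibrium E (N r) (b r) T p (\<sigma> r)"
  defines "y \<equiv> \<lambda>d k. unif_tail (threshold E p T (\<lambda>k x. a k * unif_tail x) d k)"
  shows "(\<lambda>r. normalized_revenue (N r) (b r) T p (\<sigma> r))
    \<longlonglongrightarrow> (\<Sum>d<T. p (T - d) * (\<Sum>k\<in>UNIV. a k * (y (Suc d) k - y d k)))"
proof -
  let ?X = "\<lambda>r d k v. emp_tail (N r) (b r) v k (threshold E p T (emp_tail (N r) (b r) v) d k)"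
  have int: "integrable (valuations (N r)) (?X r d k)" for r d k
    using integrable_threshold[of "N r" E p T "b r"] by (intro integrable_emp_tail) auto
  have X: "(\<lambda>r. \<integral>v. ?X r d k v \<partial>valuations (N r)) \<longlonglongrightarrow> a k * y d k" for d k
  proof -
    have L1: "(\<lambda>r. \<integral>v. \<bar>?X r d k v - a k * y d k\<bar> \<partial>valuations (N r)) \<longlonglongrightarrow> 0"
      unfolding y_def
      by (rule emp_tail_L1_random[OF N sizes _ _ integrable_threshold threshold_L1[OF N sizes a E]])
        (use a in auto)
    have "norm ((\<integral>v. ?X r d k v \<partial>valuations (N r)) - a k * y d k)
        \<le> (\<integral>v. \<bar>?X r d k v - a k * y d k\<bar> \<partial>valuations (N r))" for r
    proof -
      interpret prob_space "valuations (N r)" by (rule prob_space_valuations)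
      have "expectation (?X r d k) - a k * y d k = expectation (\<lambda>v. ?X r d k v - a k * y d k)"
        using int by (simp add: prob_space)
      then show ?thesis by (simp only: real_norm_def) (rule integral_abs_bound)
    qed
    then have "(\<lambda>r. (\<integral>v. ?X r d k v \<partial>valuations (N r)) - a k * y d k) \<longlonglongrightarrow> 0"
      by (intro Lim_null_comparison[OF _ L1] always_eventually allI)
    then show ?thesis by (rule LIM_zero_cancel)
  qed
  have "normalized_revenue (N r) (b r) T p (\<sigma> r) =
      (\<Sum>d<T. p (T - d) * (\<Sum>k\<in>UNIV. (\<integral>v. ?X r (Suc d) k v \<partial>valuations (N r)) - (\<integral>v. ?X r d k v \<partial>valuations (N r))))" for r
  proof -
    have "normalized_revenue (N r) (b r) T p (\<sigma> r) =
        (\<integral>v. (\<Sum>i<N r. case outcome_of (N r) (b r) T (\<sigma> r) v i of None \<Rightarrow> 0 | Some t \<Rightarrow> p t) / real (N r) \<partial>valuations (N r))"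
      by (simp add: normalized_revenue_def)
    also have "\<dots> = (\<integral>v. (\<Sum>d<T. p (T - d) * (\<Sum>k\<in>UNIV. ?X r (Suc d) k v - ?X r d k v)) \<partial>valuations (N r))"
    proof (rule Bochner_Integration.integral_cong[OF refl])
      fix v assume "v \<in> space (valuations (N r))"
      then have "v i \<in> {0..1}" if "i < N r" for i
        using that by (auto simp: space_PiM space_restrict_space dest!: PiE_mem[of _ _ _ i])
      then show "(\<Sum>i<N r. case outcome_of (N r) (b r) T (\<sigma> r) v i of None \<Rightarrow> 0 | Some t \<Rightarrow> p t) / real (N r) =
          (\<Sum>d<T. p (T - d) * (\<Sum>k\<in>UNIV. ?X r (Suc d) k v - ?X r d k v))"
        by (rule realized_revenue[OF E eq])
    qed
    also have "\<dots> = (\<Sum>d<T. p (T - d) * (\<Sum>k\<in>UNIV. (\<integral>v. ?X r (Suc d) k v \<partial>valuations (N r)) - (\<integral>v. ?X r d k v \<partial>valuations (N r))))"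
      by (simp only: Bochner_Integration.integral_sum Bochner_Integration.integral_diff integral_mult_right_zero
          Bochner_Integration.integrable_sum Bochner_Integration.integrable_diff integrable_mult_right int)
    finally show ?thesis .
  qed
  then show ?thesis
    by (simp only: right_diff_distrib) (intro tendsto_sum tendsto_mult tendsto_diff tendsto_const X)
qed

section \<open>The optimal price sequence\<close>

lemma matrix_diag_component: "(E ** diag a) $ k $ h = E $ k $ h * a $ h"
  by (simp add: matrix_matrix_mult_def diag_def if_distrib cong: if_cong)

lemma diag_mult_component: "(diag a *v x) $ k = a $ k * x $ k"
  by (simp add: matrix_vector_mult_def diag_def if_distrib[where f = "\<lambda>z. z * w" for w] cong: if_cong)

lemma sum_matrix_vector_mult:
  fixes A :: "nat \<Rightarrow> real^'m^'m"
  shows "(\<Sum>k<T. A k) *v x = (\<Sum>k<T. A k *v x)"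
  by (induction T) (auto simp: matrix_vector_mult_add_rdistrib)

lemma row_sum_le_norm_infty: "(\<Sum>h\<in>UNIV. \<bar>M $ k $ h\<bar>) \<le> norm_infty M"
  unfolding norm_infty_def by (intro Max_ge) auto

text \<open>Since \<open>\<alpha> $ k * N r\<close> need not be an integer, block sizes are
  prescribed only as limiting proportions. \<open>\<sigma>\<close> is an arbitrary selection of
  equilibria, one for each market and price sequence. \<open>thresholds_nonneg\<close> says that at
  price 1/2 the last-round thresholds of the limit are genuine valuations.\<close>

theorem proposition5:
  fixes E :: "real^'m^'m" and \<alpha> :: "real^'m"
    and T :: nat
    and N :: "nat \<Rightarrow> nat" and b :: "nat \<Rightarrow> nat \<Rightarrow> 'm"
    and \<sigma> :: "nat \<Rightarrow> (nat \<Rightarrow> real) \<Rightarrow> 'm strategy"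
  assumes T: "T \<ge> 1"
    and E_nonneg: "\<And>k h. E $ k $ h \<ge> 0"
    and \<alpha>: "\<And>k. 0 < \<alpha> $ k \<and> \<alpha> $ k \<le> 1"
    and norm: "norm_infty (E ** diag \<alpha>) < 1"
    and many_buyers: "filterlim N at_top sequentially"
    and block_sizes: "\<And>k. (\<lambda>r. real (card {i. i < N r \<and> b r i = k}) / real (N r)) \<longlonglongrightarrow> \<alpha> $ k"
    and equilibrium: "\<And>r p. symmetric_equilibrium E (N r) (b r) T p (\<sigma> r p)"
    and thresholds_nonneg:
      "\<And>h. 1 - 1/2 * ((\<Sum>k<T. matrix_power (E ** diag \<alpha>) k) *v 1) $ h \<ge> 0"
  shows "optimal_in_limit (\<lambda>r p. normalized_revenue (N r) (b r) T p (\<sigma> r p)) (\<lambda>t. 1/2)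
    (1/4 * (1 \<bullet> (diag \<alpha> *v ((\<Sum>k<T. matrix_power (E ** diag \<alpha>) k) *v 1))))"
proof -
  \<comment> \<open>In the limit market \<open>y p d k\<close> is the fraction of block
    \<open>k\<close> served after \<open>d\<close> rounds and \<open>L p\<close> the revenue;
    \<open>V\<close> is the claimed optimum written block by block.\<close>
  define M where "M = E ** diag \<alpha>"
  define m where "m k h = E $ k $ h * \<alpha> $ h" for k h
  define \<beta> where "\<beta> i k = (matrix_power M i *v 1) $ k" for i k
  define y where "y p d k = unif_tail (threshold E p T (\<lambda>k x. \<alpha> $ k * unif_tail x) d k)" for p d k
  define L where "L p = (\<Sum>d<T. p (T - d) * (\<Sum>k\<in>UNIV. \<alpha> $ k * (y p (Suc d) k - y p d k)))" for p
  define V where "V = (\<Sum>k\<in>UNIV. \<alpha> $ k * (1/4 * (\<Sum>i<T. \<beta> i k)))"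
  have \<alpha>01: "0 \<le> \<alpha> $ k \<and> \<alpha> $ k \<le> 1" for k using \<alpha>[of k] by simp
  have m: "M $ k $ h = m k h" for k h by (simp add: M_def m_def matrix_diag_component)
  have m_nonneg: "0 \<le> m k h" for k h using E_nonneg \<alpha>01 by (simp add: m_def)
  \<comment> \<open>The norm hypothesis enters here: no block gains more than one unit of utility
    from a fully served market.\<close>
  have m_rows: "(\<Sum>h\<in>UNIV. m k h) \<le> 1" for k
    using row_sum_le_norm_infty[of M k] norm m_nonneg by (simp add: m M_def[symmetric])
  have \<beta>_0: "\<beta> 0 k = 1" for k by (simp add: \<beta>_def)
  have \<beta>_Suc: "\<beta> (Suc i) k = (\<Sum>h\<in>UNIV. m k h * \<beta> i h)" for i k
    unfolding \<beta>_def matrix_power.simps matrix_vector_mul_assoc[symmetric]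
    by (simp add: matrix_vector_mult_def[of M] m)
  have power_sum: "((\<Sum>k<T. matrix_power M k) *v 1) $ h = (\<Sum>i<T. \<beta> i h)" for h
    by (simp add: sum_matrix_vector_mult \<beta>_def)
  have y_0: "y p 0 k = 0" for p k by (simp add: y_def unif_tail_def)
  have y_Suc: "y p (Suc d) k =
      (if candidate p (T - d) then max (y p d k) (unif_tail (p (T - d) - (\<Sum>h\<in>UNIV. m k h * y p d h)))
       else y p d k)" for p d k
    by (simp add: y_def unif_tail_min m_def mult.assoc)
  have limit: "(\<lambda>r. normalized_revenue (N r) (b r) T p (\<sigma> r p)) \<longlonglongrightarrow> L p" for p
    unfolding L_def y_def by (rule revenue_tendsto[OF many_buyers block_sizes \<alpha>01 E_nonneg equilibrium])
  have L_le: "L p \<le> V" for p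
  proof -
    have "L p = (\<Sum>d<T. \<Sum>k\<in>UNIV. \<alpha> $ k * (p (T - d) * (y p (Suc d) k - y p d k)))"
      by (simp only: L_def sum_distrib_left mult.left_commute)
    \<comment> \<open>Exchanging the sums lets \<open>block_revenue_le\<close> be applied to one
      block at a time.\<close>
    also have "\<dots> = (\<Sum>k\<in>UNIV. \<alpha> $ k * (\<Sum>d<T. p (T - d) * (y p (Suc d) k - y p d k)))"
      by (subst sum.swap) (simp only: sum_distrib_left)
    also have "\<dots> \<le> V"
      unfolding V_def
      by (intro sum_mono mult_left_mono block_revenue_le[where m = m and \<beta> = \<beta>] m_nonneg m_rows \<beta>_0 \<beta>_Suc y_0 y_Suc)
        (use \<alpha>01 in auto)
    finally show ?thesis .
  qed
  have L_half: "L (\<lambda>t. 1/2) = V"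
  proof -
    let ?y = "y (\<lambda>t. 1/2)"
    \<comment> \<open>\<open>thresholds_nonneg\<close> is used in this form: no block sells to more
      buyers than it has.\<close>
    have le: "1/2 * (\<Sum>i<T. \<beta> i k) \<le> 1" for k
      using thresholds_nonneg[of k] by (simp add: M_def[symmetric] power_sum)
    have sales: "?y T k = 1/2 * (\<Sum>i<T. \<beta> i k)" for k
      by (rule constant_half_sales[where m = m and y = ?y, OF m_nonneg \<beta>_0 \<beta>_Suc y_0 _ le order_refl])
        (simp add: y_Suc candidate_def)
    \<comment> \<open>At a constant price the sales telescope, so revenue is half the total fraction
      served.\<close>
    have "L (\<lambda>t. 1/2) = (\<Sum>k\<in>UNIV. \<Sum>d<T. 1/2 * (\<alpha> $ k * (?y (Suc d) k - ?y d k)))"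
      unfolding L_def sum_distrib_left by (rule sum.swap)
    also have "\<dots> = (\<Sum>k\<in>UNIV. 1/2 * (\<alpha> $ k * (?y T k - ?y 0 k)))"
      by (simp only: sum_distrib_left[symmetric] sum_lessThan_telescope[of "\<lambda>d. ?y d k" for k])
    also have "\<dots> = V" by (simp add: V_def sales y_0 cong: sum.cong)
    finally show ?thesis .
  qed
  have V: "1/4 * (1 \<bullet> (diag \<alpha> *v ((\<Sum>k<T. matrix_power (E ** diag \<alpha>) k) *v 1))) = V"
    by (simp add: V_def inner_vec_def diag_mult_component M_def[symmetric] power_sum sum_distrib_left)
  show ?thesis
    unfolding optimal_in_limit_def V
  proof (intro conjI allI)
    show "(\<lambda>r. normalized_revenue (N r) (b r) T (\<lambda>t. 1/2) (\<sigma> r (\<lambda>t. 1/2))) \<longlonglongrightarrow> V"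
      using limit[of "\<lambda>t. 1/2"] by (simp only: L_half)
    show "\<exists>l. (\<lambda>r. normalized_revenue (N r) (b r) T q (\<sigma> r q)) \<longlonglongrightarrow> l \<and> l \<le> V" for q
      using limit[of q] L_le[of q] by blast
  qed
qed

end
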